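(* Let $(Y,\tau)$ be a topological space and $(Z,\mathcal{U})$ a uniform space. A topology $\mathfrak{T}$ on $EC(Y,Z)$ is admissible if and only if for each net $\{f_n\}_{n\in\Delta}$ in $EC(Y,Z)$ and each $f\in EC(Y,Z)$, convergence of $\{f_n\}_{n\in\Delta}$ to $f$ in $(EC(Y,Z),\mathfrak{T})$ implies equi-continuous convergence of $\{f_n\}_{n\in\Delta}$ to $f$.
   Context: Uniform spaces $(Z,\mathcal{U})$ are given in the usual sense by a family $\mathcal{U}$ of entourages on a non-empty set $Z$. For $U\in\mathcal{U}$ and $z\in Z$, $U[z]=\{w\in Z : (z,w)\in U\}$. Equi-continuity: a function $f:(X,\tau)\to(Z,\mathcal{U})$ from a topological space to a uniform space is equi-continuous at $x\in X$ if for each $U\in\mathcal{U}$ there is an open neighbourhood $V$ of $x$ with $f(V)\subseteq U[f(x)]$; it is equi-continuous if this holds at all $x\in X$. $EC(Y,Z)$ is the set of all equi-continuous functions from $Y$ to $Z$. Net convergence in a uniform space: a net $\{z_n\}_{n\in D}$ in $(Z,\mathcal{U})$ converges to $z$ if for each $U\in\mathcal{U}$ there is $m\in D$ with $(z,z_n)\in U$ for all $n\ge m$. Equi-continuous convergence: a net $\{f_n\}_{n\in\Delta}$ in $EC(Y,Z)$ equi-continuously converges to $f\in EC(Y,Z)$ if for each net $\{y_m\}_{m\in\sigma}$ in $Y$ converging to a point $y\in Y$, the net $\{f_n(y_m)\}_{(n,m)\in\Delta\times\sigma}$ (indexed by the product directed set) converges to $f(y)$ in $Z$. Admissible: a topology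 $\mathfrak{T}$ on $EC(Y,Z)$ is admissible if the evaluation map $e:EC(Y,Z)\times Y\to Z$, $e(f,y)=f(y)$, is equi-continuous (where $EC(Y,Z)\times Y$ has the product topology of $\mathfrak{T}$ and $\tau$). *)

theory Defs
  imports "HOL-Analysis.Analysis"
begin

definition entourage_family :: "'z set \<Rightarrow> ('z \<times> 'z) set set \<Rightarrow> bool" where
  "entourage_family Z \<U> \<longleftrightarrow>
     Z \<noteq> {} \<and> \<U> \<noteq> {} \<and>
     (\<forall>U\<in>\<U>. U \<subseteq> Z \<times> Z \<and> Id_on Z \<subseteq> U) \<and>
     (\<forall>U\<in>\<U>. U\<inverse> \<in> \<U>) \<and>
     (\<forall>U\<in>\<U>. \<exists>V\<in>\<U>. V O V \<subseteq> U) \<and>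
     (\<forall>U\<in>\<U>. \<forall>V\<in>\<U>. U \<inter> V \<in> \<U>) \<and>
     (\<forall>U\<in>\<U>. \<forall>V. U \<subseteq> V \<and> V \<subseteq> Z \<times> Z \<longrightarrow> V \<in> \<U>)"

text \<open>For \<open>U \<subseteq> Z \<times> Z\<close>, the set \<open>U[z]\<close> is the relational image \<open>U `` {z}\<close>.\<close>

definition equicontinuous_at ::
    "'x topology \<Rightarrow> ('z \<times> 'z) set set \<Rightarrow> ('x \<Rightarrow> 'z) \<Rightarrow> 'x \<Rightarrow> bool" where
  "equicontinuous_at X \<U> f x \<longleftrightarrow>
     (\<forall>U\<in>\<U>. \<exists>V. openin X V \<and> x \<in> V \<and> f ` V \<subseteq> U `` {f x})"

definition equicontinuous ::
    "'x topology \<Rightarrow> 'z set \<Rightarrow> ('z \<times> 'z) set set \<Rightarrow> ('x \<Rightarrow> 'z) \<Rightarrow> bool" where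
  "equicontinuous X Z \<U> f \<longleftrightarrow>
     f \<in> topspace X \<rightarrow> Z \<and> (\<forall>x\<in>topspace X. equicontinuous_at X \<U> f x)"

text \<open>Functions on the carrier of \<open>Y\<close> are represented by their extensional versions, so that
  elements of \<open>EC\<close> correspond one-to-one to functions from \<open>Y\<close> to \<open>Z\<close>.\<close>

definition EC :: "'y topology \<Rightarrow> 'z set \<Rightarrow> ('z \<times> 'z) set set \<Rightarrow> ('y \<Rightarrow> 'z) set" where
  "EC Y Z \<U> = {f \<in> topspace Y \<rightarrow>\<^sub>E Z. equicontinuous Y Z \<U> f}"

text \<open>\<open>(m, n) \<in> r\<close> is read as \<open>n \<ge> m\<close>.\<close>

definition directed_set :: "'d set \<Rightarrow> 'd rel \<Rightarrow> bool" where
  "directed_set D r \<longleftrightarrow>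
     D \<noteq> {} \<and> preorder_on D r \<and> (\<forall>a\<in>D. \<forall>b\<in>D. \<exists>c\<in>D. (a, c) \<in> r \<and> (b, c) \<in> r)"

definition prod_order :: "'d rel \<Rightarrow> 'e rel \<Rightarrow> ('d \<times> 'e) rel" where
  "prod_order r s = {((a, b), (a', b')). (a, a') \<in> r \<and> (b, b') \<in> s}"

definition net_in :: "'d set \<Rightarrow> 'd rel \<Rightarrow> ('d \<Rightarrow> 'x) \<Rightarrow> 'x set \<Rightarrow> bool" where
  "net_in D r x X \<longleftrightarrow> directed_set D r \<and> x \<in> D \<rightarrow> X"

definition net_converges ::
    "'x topology \<Rightarrow> 'd set \<Rightarrow> 'd rel \<Rightarrow> ('d \<Rightarrow> 'x) \<Rightarrow> 'x \<Rightarrow> bool" where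
  "net_converges X D r x l \<longleftrightarrow>
     l \<in> topspace X \<and>
     (\<forall>V. openin X V \<and> l \<in> V \<longrightarrow> (\<exists>m\<in>D. \<forall>n\<in>D. (m, n) \<in> r \<longrightarrow> x n \<in> V))"

definition unif_net_converges ::
    "'z set \<Rightarrow> ('z \<times> 'z) set set \<Rightarrow> 'd set \<Rightarrow> 'd rel \<Rightarrow> ('d \<Rightarrow> 'z) \<Rightarrow> 'z \<Rightarrow> bool" where
  "unif_net_converges Z \<U> D r z l \<longleftrightarrow>
     l \<in> Z \<and> (\<forall>U\<in>\<U>. \<exists>m\<in>D. \<forall>n\<in>D. (m, n) \<in> r \<longrightarrow> (l, z n) \<in> U)"

text \<open>HOL cannot quantify over types inside a formula, so the type \<open>'s\<close> from which the index
  sets of the nets in \<open>Y\<close> are drawn is an explicit parameter.\<close>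

definition equicont_converges ::
    "'s itself \<Rightarrow> 'y topology \<Rightarrow> 'z set \<Rightarrow> ('z \<times> 'z) set set \<Rightarrow>
     'd set \<Rightarrow> 'd rel \<Rightarrow> ('d \<Rightarrow> 'y \<Rightarrow> 'z) \<Rightarrow> ('y \<Rightarrow> 'z) \<Rightarrow> bool" where
  "equicont_converges (t :: 's itself) Y Z \<U> D r F f \<longleftrightarrow>
     (\<forall>(S :: 's set) s y l.
        net_in S s y (topspace Y) \<and> net_converges Y S s y l \<longrightarrow>
        unif_net_converges Z \<U> (D \<times> S) (prod_order r s) (\<lambda>(n, m). F n (y m)) (f l))"

definition admissible ::
    "'y topology \<Rightarrow> 'z set \<Rightarrow> ('z \<times> 'z) set set \<Rightarrow> ('y \<Rightarrow> 'z) topology \<Rightarrow> bool" where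
  "admissible Y Z \<U> T \<longleftrightarrow> equicontinuous (prod_topology T Y) Z \<U> (\<lambda>(f, y). f y)"

end

theory Submission
  imports Defs
begin

text \<open>If admissibility fails at \<open>(f, y)\<close> for an entourage \<open>U\<close>, pick from every basic neighbourhood
  \<open>A \<times> B\<close> of \<open>(f, y)\<close> a pair \<open>(g, x)\<close> with \<open>(f y, g x) \<notin> U\<close>. Both components are nets over the
  neighbourhood base and converge to \<open>f\<close> and \<open>y\<close>, but along the diagonal of the product index set
  the evaluations never enter \<open>U[f y]\<close>.\<close>

text \<open>Open rectangles \<open>A \<times> B\<close> form a base of the product topology, so
  equi-continuity of evaluation at \<open>(f, y)\<close> can be tested on them. Both directions
  below work with this form.\<close>

lemma admissible_iff:
  assumes "topspace T = EC Y Z \<U>"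
  shows "admissible Y Z \<U> T \<longleftrightarrow>
    (\<forall>f\<in>EC Y Z \<U>. \<forall>y\<in>topspace Y. \<forall>U\<in>\<U>.
       \<exists>A B. openin T A \<and> f \<in> A \<and> openin Y B \<and> y \<in> B \<and> (\<forall>g\<in>A. \<forall>x\<in>B. (f y, g x) \<in> U))"
    (is "_ \<longleftrightarrow> ?R")
proof
  assume adm: "admissible Y Z \<U> T"
  show ?R
  proof (intro ballI)
    fix f y U assume f: "f \<in> EC Y Z \<U>" and y: "y \<in> topspace Y" and U: "U \<in> \<U>"
    from adm f y U assms obtain V where V: "openin (prod_topology T Y) V" "(f, y) \<in> V"
      "(\<lambda>(f, y). f y) ` V \<subseteq> U `` {f y}"
      unfolding admissible_def equicontinuous_def equicontinuous_at_def by fastforce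
    from V(1,2) obtain A B where AB: "openin T A" "openin Y B" "f \<in> A" "y \<in> B" "A \<times> B \<subseteq> V"
      unfolding openin_prod_topology_alt by meson
    have "(f y, g x) \<in> U" if "g \<in> A" "x \<in> B" for g x
      using that AB(5) V(3) by auto
    with AB(1-4) show "\<exists>A B. openin T A \<and> f \<in> A \<and> openin Y B \<and> y \<in> B \<and>
        (\<forall>g\<in>A. \<forall>x\<in>B. (f y, g x) \<in> U)"
      by meson
  qed
next
  assume R: ?R
  have "\<exists>V. openin (prod_topology T Y) V \<and> (f, y) \<in> V \<and> (\<lambda>(f, y). f y) ` V \<subseteq> U `` {f y}"
    if fyU: "f \<in> EC Y Z \<U>" "y \<in> topspace Y" "U \<in> \<U>" for f y U
  proof -
    from R fyU obtain A B where "openin T A" "f \<in> A" "openin Y B" "y \<in> B"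
      "\<forall>g\<in>A. \<forall>x\<in>B. (f y, g x) \<in> U" by meson
    then show ?thesis
      by (intro exI[of _ "A \<times> B"]) (auto simp: openin_prod_Times_iff)
  qed
  moreover have "(\<lambda>(f, y). f y) \<in> EC Y Z \<U> \<times> topspace Y \<rightarrow> Z"
    by (auto simp: EC_def)
  ultimately show "admissible Y Z \<U> T"
    using assms by (auto simp: admissible_def equicontinuous_def equicontinuous_at_def)
qed

text \<open>A rectangle \<open>A \<times> B\<close> on which evaluation stays in
  \<open>U[f l]\<close> splits the task: \<open>F\<close> is in \<open>A\<close> from some
  \<open>a\<close> on, \<open>y\<close> is in \<open>B\<close> from some \<open>b\<close> on, and
  \<open>(a, b)\<close> starts the required tail of the product net. The index types stay
  arbitrary.\<close>

lemma admissible_imp_equicont_converges: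
  assumes T: "topspace T = EC Y Z \<U>" and adm: "admissible Y Z \<U> T"
    and f: "f \<in> EC Y Z \<U>" and conv: "net_converges T D r F f"
  shows "equicont_converges TYPE('s) Y Z \<U> D r F f"
  unfolding equicont_converges_def
proof (intro allI impI)
  fix S :: "'s set" and s y l
  assume "net_in S s y (topspace Y) \<and> net_converges Y S s y l"
  then have y: "net_converges Y S s y l" and l: "l \<in> topspace Y"
    by (auto simp: net_converges_def)
  have "\<exists>p\<in>D \<times> S. \<forall>q\<in>D \<times> S. (p, q) \<in> prod_order r s \<longrightarrow> (f l, (\<lambda>(n, m). F n (y m)) q) \<in> U"
    if U: "U \<in> \<U>" for U
  proof -
    obtain A B where AB: "openin T A" "f \<in> A" "openin Y B" "l \<in> B"
      "\<forall>g\<in>A. \<forall>x\<in>B. (f l, g x) \<in> U"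
      using adm f l U unfolding admissible_iff[OF T] by meson
    obtain a where "a \<in> D" "\<forall>n\<in>D. (a, n) \<in> r \<longrightarrow> F n \<in> A"
      using conv AB unfolding net_converges_def by meson
    moreover obtain b where "b \<in> S" "\<forall>m\<in>S. (b, m) \<in> s \<longrightarrow> y m \<in> B"
      using y AB unfolding net_converges_def by meson
    ultimately show ?thesis
      using AB(5) by (intro bexI[of _ "(a, b)"]) (auto simp: prod_order_def)
  qed
  moreover have "f l \<in> Z"
    using f l by (auto simp: EC_def)
  ultimately show "unif_net_converges Z \<U> (D \<times> S) (prod_order r s) (\<lambda>(n, m). F n (y m)) (f l)"
    by (auto simp: unif_net_converges_def)
qed

lemma equicont_converges_imp_admissible:
  fixes Y :: "'y topology" and T :: "('y \<Rightarrow> 'z) topology"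
  assumes T: "topspace T = EC Y Z \<U>"
    and conv: "\<And>(D :: (('y \<Rightarrow> 'z) set \<times> 'y set) set) r F f.
      \<lbrakk>f \<in> EC Y Z \<U>; net_in D r F (EC Y Z \<U>); net_converges T D r F f\<rbrakk> \<Longrightarrow>
      equicont_converges TYPE(('y \<Rightarrow> 'z) set \<times> 'y set) Y Z \<U> D r F f"
  shows "admissible Y Z \<U> T"
  unfolding admissible_iff[OF T]
proof (intro ballI, rule ccontr)
  fix f y U
  assume f: "f \<in> EC Y Z \<U>" and y: "y \<in> topspace Y" and U: "U \<in> \<U>"
    and neg: "\<nexists>A B. openin T A \<and> f \<in> A \<and> openin Y B \<and> y \<in> B \<and> (\<forall>g\<in>A. \<forall>x\<in>B. (f y, g x) \<in> U)"
  define D where "D = {(A, B). openin T A \<and> f \<in> A \<and> openin Y B \<and> y \<in> B}"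
  \<comment> \<open>Reverse inclusion in both components: later indices are smaller
    neighbourhoods.\<close>
  define r where "r = {((A, B), (A', B')). (A, B) \<in> D \<and> (A', B') \<in> D \<and> A' \<subseteq> A \<and> B' \<subseteq> B}"
  have "\<forall>d\<in>D. \<exists>p. fst p \<in> fst d \<and> snd p \<in> snd d \<and> (f y, (fst p) (snd p)) \<notin> U"
  proof
    fix d assume "d \<in> D"
    then have "\<not> (\<forall>g\<in>fst d. \<forall>x\<in>snd d. (f y, g x) \<in> U)"
      using neg by (auto simp: D_def)
    then show "\<exists>p. fst p \<in> fst d \<and> snd p \<in> snd d \<and> (f y, (fst p) (snd p)) \<notin> U"
      by force
  qed
  then obtain c where c: "\<And>d. d \<in> D \<Longrightarrow>
      fst (c d) \<in> fst d \<and> snd (c d) \<in> snd d \<and> (f y, (fst (c d)) (snd (c d))) \<notin> U"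
    by metis
  define F where "F = (\<lambda>d. fst (c d))"
  define x where "x = (\<lambda>d. snd (c d))"
  have top: "(topspace T, topspace Y) \<in> D"
    using f y openin_topspace[of T] unfolding T D_def by simp
  \<comment> \<open>Componentwise intersection gives an upper bound; besides directedness, this
    later yields the diagonal index.\<close>
  have common: "\<exists>d\<in>D. (a, d) \<in> r \<and> (b, d) \<in> r" if "a \<in> D" "b \<in> D" for a b
    using that by (intro bexI[of _ "(fst a \<inter> fst b, snd a \<inter> snd b)"]) (auto simp: D_def r_def)
  have dir: "directed_set D r"
    unfolding directed_set_def preorder_on_def
    using top common by (auto simp: refl_on_def trans_def r_def)
  have FD: "F d \<in> fst d" and xD: "x d \<in> snd d" and FxU: "(f y, F d (x d)) \<notin> U" if "d \<in> D" for d
    using c[OF that] by (auto simp: F_def x_def)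
  have D_open: "openin T (fst d)" "openin Y (snd d)" if "d \<in> D" for d
    using that by (auto simp: D_def)
  have "F d \<in> EC Y Z \<U>" if "d \<in> D" for d
    using subsetD[OF openin_subset[OF D_open(1)[OF that]] FD[OF that]] T by simp
  then have netF: "net_in D r F (EC Y Z \<U>)"
    using dir by (simp add: net_in_def)
  have "x d \<in> topspace Y" if "d \<in> D" for d
    using subsetD[OF openin_subset[OF D_open(2)[OF that]] xD[OF that]] .
  then have netx: "net_in D r x (topspace Y)"
    using dir by (simp add: net_in_def)
  have "net_converges T D r F f"
    unfolding net_converges_def
  proof (intro conjI allI impI)
    fix V assume V: "openin T V \<and> f \<in> V"
    show "\<exists>m\<in>D. \<forall>n\<in>D. (m, n) \<in> r \<longrightarrow> F n \<in> V"
    proof (intro bexI ballI impI)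
      \<comment> \<open>The second component is left as large as possible, since only the first one
        constrains \<open>F\<close>.\<close>
      show "(V, topspace Y) \<in> D" using V y by (simp add: D_def)
      fix n assume "n \<in> D" "((V, topspace Y), n) \<in> r"
      then show "F n \<in> V" using FD[of n] by (auto simp: r_def)
    qed
  qed (use f T in simp)
  moreover have "net_converges Y D r x y"
    unfolding net_converges_def
  proof (intro conjI allI impI)
    fix V assume V: "openin Y V \<and> y \<in> V"
    show "\<exists>m\<in>D. \<forall>n\<in>D. (m, n) \<in> r \<longrightarrow> x n \<in> V"
    proof (intro bexI ballI impI)
      show "(topspace T, V) \<in> D" using V f openin_topspace[of T] unfolding T D_def by simp
      fix n assume "n \<in> D" "((topspace T, V), n) \<in> r"
      then show "x n \<in> V" using xD[of n] by (auto simp: r_def)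
    qed
  qed (use y in simp)
  ultimately have "unif_net_converges Z \<U> (D \<times> D) (prod_order r r) (\<lambda>(n, m). F n (x m)) (f y)"
    using conv[OF f netF] netx unfolding equicont_converges_def by blast
  then obtain a b where ab: "a \<in> D" "b \<in> D"
    "\<forall>n\<in>D. \<forall>m\<in>D. (a, n) \<in> r \<longrightarrow> (b, m) \<in> r \<longrightarrow> (f y, F n (x m)) \<in> U"
    using U unfolding unif_net_converges_def prod_order_def by fastforce
  \<comment> \<open>The tail starts at \<open>(a, b)\<close> with \<open>a\<close> and
    \<open>b\<close> possibly different. A common upper bound \<open>d\<close> puts the diagonal
    index \<open>(d, d)\<close> into it, where \<open>F d (x d)\<close> was chosen outside
    \<open>U[f y]\<close>.\<close>
  then obtain d where "d \<in> D" "(a, d) \<in> r" "(b, d) \<in> r"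
    using common by meson
  then show False
    using ab FxU by blast
qed

(* "Each net" ranges over index sets of arbitrary size. The equivalence is stated for nets whose
   index sets are drawn from a concrete, sufficiently large type; the second conjunct gives the
   implication from admissibility for nets over index sets of arbitrary types 'd and 's. *)
theorem theorem4p8:
  fixes Y :: "'y topology" and Z :: "'z set" and \<U> :: "('z \<times> 'z) set set"
    and T :: "('y \<Rightarrow> 'z) topology"
  assumes "entourage_family Z \<U>"
    and "topspace T = EC Y Z \<U>"
  shows "(admissible Y Z \<U> T \<longleftrightarrow>
            (\<forall>(D :: (('y \<Rightarrow> 'z) set \<times> 'y set) set) r F. \<forall>f \<in> EC Y Z \<U>.
               net_in D r F (EC Y Z \<U>) \<longrightarrow> net_converges T D r F f \<longrightarrow>
               equicont_converges TYPE(('y \<Rightarrow> 'z) set \<times> 'y set) Y Z \<U> D r F f)) \<and>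
         (admissible Y Z \<U> T \<longrightarrow>
            (\<forall>(D :: 'd set) r F. \<forall>f \<in> EC Y Z \<U>.
               net_in D r F (EC Y Z \<U>) \<longrightarrow> net_converges T D r F f \<longrightarrow>
               equicont_converges TYPE('s) Y Z \<U> D r F f))"
proof (intro conjI iffI allI ballI impI)
  show "admissible Y Z \<U> T"
    if "\<forall>(D :: (('y \<Rightarrow> 'z) set \<times> 'y set) set) r F. \<forall>f \<in> EC Y Z \<U>.
      net_in D r F (EC Y Z \<U>) \<longrightarrow> net_converges T D r F f \<longrightarrow>
      equicont_converges TYPE(('y \<Rightarrow> 'z) set \<times> 'y set) Y Z \<U> D r F f"
    by (rule equicont_converges_imp_admissible[OF assms(2)]) (use that in simp)
\<comment> \<open>The lemma is polymorphic in both index types, so it closes the forward half of the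
  equivalence as well as the second conjunct.\<close>
qed (rule admissible_imp_equicont_converges[OF assms(2)]; assumption)+

end
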